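(* There are infinitely many pairwise non-isomorphic connected graphs $G$ with vertex-connectivity $\kappa(G)=1$ that admit an IRC-coloring.
   Context: Private neighbors. For $S\subseteq V(G)$ and $v\in S$, $pn[v,S]=N[v]\setminus\bigcup_{u\in S\setminus\{v\}}N[u]$, where $N[\cdot]$ is the closed neighborhood. $S$ is irredundant if $pn[v,S]\ne\emptyset$ for all $v\in S$. Rainbow committees and IRC-colorings. For a proper coloring of $G$ with nonempty color classes $V_1,\dots,V_k$, a rainbow committee is a set containing exactly one vertex of each color class. An irredundance compelling coloring (IRC-coloring) is a proper coloring in which every rainbow committee is an irredundant set. *)

theory Defs
  imports "Graph_Theory.Graph_Theory"
begin

text \<open>
  Finite simple graphs are values \<open>G\<close> of type \<open>'a pair_pre_digraph\<close> with \<open>pair_graph G\<close>: a finite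
  vertex set with a symmetric, irreflexive set of arcs, an edge \<open>uv\<close> being the two arcs
  \<open>(u, v)\<close> and \<open>(v, u)\<close>. The constant \<open>Digraph_Component.connected\<close> includes nonemptiness.
\<close>

definition closed_nbhd :: "'a pair_pre_digraph \<Rightarrow> 'a \<Rightarrow> 'a set" where
  "closed_nbhd G v = insert v {u. (v, u) \<in> parcs G}"

definition private_nbrs :: "'a pair_pre_digraph \<Rightarrow> 'a \<Rightarrow> 'a set \<Rightarrow> 'a set" where
  "private_nbrs G v S = closed_nbhd G v - (\<Union>u \<in> S - {v}. closed_nbhd G u)"

definition irredundant :: "'a pair_pre_digraph \<Rightarrow> 'a set \<Rightarrow> bool" where
  "irredundant G S \<longleftrightarrow> S \<subseteq> pverts G \<and> (\<forall>v\<in>S. private_nbrs G v S \<noteq> {})"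

text \<open>Surjectivity onto \<open>{1..k}\<close> says that every colour class is nonempty.\<close>

definition proper_coloring :: "'a pair_pre_digraph \<Rightarrow> nat \<Rightarrow> ('a \<Rightarrow> nat) \<Rightarrow> bool" where
  "proper_coloring G k c \<longleftrightarrow>
     c ` pverts G = {1..k} \<and> (\<forall>u v. (u, v) \<in> parcs G \<longrightarrow> c u \<noteq> c v)"

definition rainbow_committee ::
  "'a pair_pre_digraph \<Rightarrow> nat \<Rightarrow> ('a \<Rightarrow> nat) \<Rightarrow> 'a set \<Rightarrow> bool" where
  "rainbow_committee G k c S \<longleftrightarrow>
     S \<subseteq> pverts G \<and> (\<forall>i\<in>{1..k}. \<exists>!v. v \<in> S \<and> c v = i)"

definition IRC_coloring :: "'a pair_pre_digraph \<Rightarrow> nat \<Rightarrow> ('a \<Rightarrow> nat) \<Rightarrow> bool" where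
  "IRC_coloring G k c \<longleftrightarrow>
     proper_coloring G k c \<and> (\<forall>S. rainbow_committee G k c S \<longrightarrow> irredundant G S)"

text \<open>
  The least number of vertices whose deletion leaves a disconnected graph or a single vertex,
  so that the complete graph on \<open>n\<close> vertices gets the value \<open>n - 1\<close>.
\<close>

definition vertex_connectivity :: "'a pair_pre_digraph \<Rightarrow> nat" where
  "vertex_connectivity G =
     (LEAST k. \<exists>S \<subseteq> pverts G. card S = k \<and>
        (\<not> Digraph_Component.connected (with_proj G \<restriction> (pverts G - S)) \<or> card (pverts G - S) = 1))"

end

theory Submission
  imports Defs
begin

text \<open>
  In a bipartite graph without vertices of degree at most 1, the bipartition is an IRC-colouring:
  for a committee \<open>{u, v}\<close>, any neighbour of \<open>v\<close> other than \<open>u\<close> lies in the class of \<open>u\<close>, so it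
  is a private neighbour of \<open>v\<close>. Two complete bipartite graphs glued at one vertex are of this
  kind and have a cut vertex, and their sizes are unbounded.
\<close>

lemma IRC_coloring_bipartite:
  assumes G: "pair_wf_digraph G" and c: "proper_coloring G 2 c"
    and deg: "\<And>u v. v \<in> pverts G \<Longrightarrow> \<exists>w. w \<noteq> u \<and> (v, w) \<in> parcs G"
  shows "IRC_coloring G 2 c"
proof -
  have two: "c v = 1 \<or> c v = 2" if "v \<in> pverts G" for v
  proof -
    have "c v \<in> {1..2}" using c that unfolding proper_coloring_def by blast
    then show ?thesis by auto
  qed
  have "private_nbrs G v S \<noteq> {}" if S: "rainbow_committee G 2 c S" and v: "v \<in> S" for S v
  proof -
    have sub: "S \<subseteq> pverts G" using S by (simp add: rainbow_committee_def)
    have inj: "x = y" if "x \<in> S" "y \<in> S" "c x = c y" for x y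
    proof -
      have "x \<in> pverts G" using sub that(1) by blast
      \<comment> \<open>\<open>rainbow_committee\<close> asserts uniqueness only for colours in the
        range, so the colour of \<open>x\<close> has to be placed there first.\<close>
      then have "c x \<in> {1..2}" using two[of x] by auto
      then show ?thesis using S that unfolding rainbow_committee_def by metis
    qed
    \<comment> \<open>\<open>u\<close> is the other committee member. If \<open>S = {v}\<close>, any
      \<open>u\<close> will do, so the size of \<open>S\<close> need not be computed.\<close>
    obtain u where u: "S - {v} \<subseteq> {u}"
    proof (cases "S = {v}")
      case False
      then obtain u where "u \<in> S" "u \<noteq> v" using v by blast
      then have "S - {v} \<subseteq> {u}"
        using inj two sub v by (smt (verit) Diff_iff insertCI subsetD subsetI)
      then show ?thesis using that by blast
    qed (use that in auto)
    \<comment> \<open>\<open>deg\<close> is minimum degree 2 stated without counting, in the form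
      needed here: a neighbour avoiding one prescribed vertex.\<close>
    obtain w where w: "w \<noteq> u" "(v, w) \<in> parcs G" using deg sub v by blast
    have "w \<notin> closed_nbhd G u'" if u': "u' \<in> S - {v}" for u'
    proof -
      have "u' = u" using u u' by blast
      have "c u' \<noteq> c v" using inj u' v by blast
      moreover have "c w \<noteq> c v" using c w(2) unfolding proper_coloring_def by metis
      moreover have "w \<in> pverts G" using G w(2) by (rule pair_wf_digraph.in_arcsD2)
      ultimately have "c w = c u'" using two u' v sub by (metis DiffD1 subsetD)
      then show ?thesis
        using c w(1) \<open>u' = u\<close> unfolding proper_coloring_def closed_nbhd_def by force
    qed
    then show ?thesis using w(2) by (auto simp: private_nbrs_def closed_nbhd_def)
  qed
  then show ?thesis using c by (auto simp: IRC_coloring_def irredundant_def rainbow_committee_def)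
qed

lemma digraph_iso_card_verts: "digraph_iso G H \<Longrightarrow> card (verts G) = card (verts H)"
  by (auto simp: digraph_iso_def pre_digraph.digraph_isomorphism_def card_image)

text \<open>The cut vertex \<open>x\<close> bounds the minimum by 1. The value 0 would force the
  deleted set to be empty, and \<open>G\<close> itself is connected and not a single vertex.\<close>

lemma vertex_connectivity_eq_1I:
  assumes "finite (pverts G)" "Digraph_Component.connected (with_proj G)" "card (pverts G) \<noteq> 1"
    and "x \<in> pverts G" "\<not> Digraph_Component.connected (with_proj G \<restriction> (pverts G - {x}))"
    and "pair_wf_digraph G"
  shows "vertex_connectivity G = 1"
  unfolding vertex_connectivity_def
proof (rule Least_equality)
  show "\<exists>S\<subseteq>pverts G. card S = 1 \<and> (\<not> Digraph_Component.connected (with_proj G \<restriction> (pverts G - S))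
      \<or> card (pverts G - S) = 1)"
    using assms(4,5) by (intro exI[of _ "{x}"]) auto
next
  fix k
  assume "\<exists>S\<subseteq>pverts G. card S = k \<and> (\<not> Digraph_Component.connected (with_proj G \<restriction> (pverts G - S))
      \<or> card (pverts G - S) = 1)"
  then obtain S where S: "S \<subseteq> pverts G" "card S = k"
    "\<not> Digraph_Component.connected (with_proj G \<restriction> (pverts G - S)) \<or> card (pverts G - S) = 1" by blast
  \<comment> \<open>Deleting nothing returns the graph itself, since by well-formedness every arc
    has both ends in \<open>pverts G\<close>.\<close>
  have "with_proj G \<restriction> pverts G = with_proj G"
    using pair_wf_digraph.arc_fst_in_verts[OF assms(6)] pair_wf_digraph.arc_snd_in_verts[OF assms(6)]
    by (auto simp: induce_subgraph_def with_proj_def)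
  then have "S \<noteq> {}" using S(3) assms(2,3) by auto
  \<comment> \<open>Finiteness excludes the default value 0 that \<open>card\<close> takes on
    infinite sets.\<close>
  then have "card S \<noteq> 0" using S(1) assms(1) by (simp add: finite_subset)
  then show "1 \<le> k" using S(2) by simp
qed

text \<open>
  The two complete bipartite graphs have parts \<open>{0, 1}\<close> and the odd numbers from 3 on,
  respectively \<open>{0, 2}\<close> and the even numbers from 4 on; they share the vertex 0.
\<close>

definition glue_edge :: "nat \<Rightarrow> nat \<Rightarrow> bool" where
  "glue_edge a b \<longleftrightarrow> 3 \<le> b \<and> (a = 0 \<or> a = 1 \<and> odd b \<or> a = 2 \<and> even b)"

definition glued_bicliques :: "nat \<Rightarrow> nat pair_pre_digraph" where
  "glued_bicliques n = \<lparr>pverts = {..<n},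
     parcs = {(u, v). u < n \<and> v < n \<and> (glue_edge u v \<or> glue_edge v u)}\<rparr>"

lemma glued_bicliques_simps [simp]:
  "pverts (glued_bicliques n) = {..<n}"
  "(u, v) \<in> parcs (glued_bicliques n) \<longleftrightarrow> u < n \<and> v < n \<and> (glue_edge u v \<or> glue_edge v u)"
  by (auto simp: glued_bicliques_def)

lemma pair_graph_glued_bicliques: "pair_graph (glued_bicliques n)"
proof
  have "parcs (glued_bicliques n) \<subseteq> {..<n} \<times> {..<n}" by auto
  then show "finite (parcs (glued_bicliques n))" by (rule finite_subset) simp
qed (auto simp: symmetric_def sym_def glue_edge_def)

lemma connected_glued_bicliques:
  assumes "7 \<le> n"
  shows "Digraph_Component.connected (with_proj (glued_bicliques n))"
proof -
  let ?R = "rtrancl_on {..<n} ((parcs (glued_bicliques n))\<^sup>s)"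
  have step: "(u, v) \<in> ?R" if "u < n" "v < n" "glue_edge u v \<or> glue_edge v u" for u v
    using that by (intro rtrancl_on_into_rtrancl_on[OF rtrancl_on_refl]) (auto simp: symcl_def)
  \<comment> \<open>The shared vertex 0 serves as a hub: every vertex from 3 on is adjacent to it,
    while 1 reaches it through 3 and 2 through 4.\<close>
  have 0: "(v, 0) \<in> ?R \<and> (0, v) \<in> ?R" if "v < n" for v
  proof -
    consider "v = 0" | "v = 1" | "v = 2" | "3 \<le> v" by linarith
    then show ?thesis
    proof cases
      case 1
      then show ?thesis using that by auto
    next
      case 2
      have "(1, 3) \<in> ?R" "(3, 0) \<in> ?R" "(0, 3) \<in> ?R" "(3, 1) \<in> ?R"
        using assms by (auto intro!: step simp: glue_edge_def)
      then show ?thesis using 2 rtrancl_on_trans by metis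
    next
      case 3
      have "(2, 4) \<in> ?R" "(4, 0) \<in> ?R" "(0, 4) \<in> ?R" "(4, 2) \<in> ?R"
        using assms by (auto intro!: step simp: glue_edge_def)
      then show ?thesis using 3 rtrancl_on_trans by metis
    next
      case 4
      then show ?thesis using that by (auto intro!: step simp: glue_edge_def)
    qed
  qed
  have "(u, v) \<in> ?R" if "u < n" "v < n" for u v
    using 0 that rtrancl_on_trans by metis
  moreover have "0 \<in> {..<n}" using assms by simp
  ultimately show ?thesis by (auto simp: connected_conv)
qed

text \<open>Once 0 is gone, every edge joins two vertices of equal parity. Parity is thus constant
  along walks, which separates 1 from 2.\<close>

lemma not_connected_glued_bicliques_minus_0:
  assumes "7 \<le> n"
  shows "\<not> Digraph_Component.connected (with_proj (glued_bicliques n) \<restriction> ({..<n} - {0}))"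
proof
  let ?H = "with_proj (glued_bicliques n) \<restriction> ({..<n} - {0})"
  assume "Digraph_Component.connected ?H"
  then have "(1, 2) \<in> rtrancl_on (verts ?H) ((arcs_ends ?H)\<^sup>s)"
    using assms unfolding connected_conv by simp
  moreover have "odd v" if "(1, v) \<in> rtrancl_on (verts ?H) ((arcs_ends ?H)\<^sup>s)" for v
    using that
  proof (induct rule: rtrancl_on_induct)
    case (step b c)
    then show ?case by (auto simp: symcl_def arcs_ends_conv glue_edge_def)
  qed simp
  ultimately show False by fastforce
qed

lemma IRC_coloring_glued_bicliques:
  assumes "7 \<le> n"
  shows "IRC_coloring (glued_bicliques n) 2 (\<lambda>v. if v < 3 then 1 else 2)"
proof (rule IRC_coloring_bipartite)
  show "pair_wf_digraph (glued_bicliques n)"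
    using pair_graph_glued_bicliques pair_graph_def pair_digraph.pair_wf_digraph by blast
  have "(\<lambda>v::nat. if v < 3 then 1 else 2::nat) ` {..<n} = {1, 2}"
  proof (intro equalityI subsetI)
    fix i :: nat assume "i \<in> {1, 2}"
    then show "i \<in> (\<lambda>v::nat. if v < 3 then 1 else 2) ` {..<n}"
      using assms by (intro image_eqI[of _ _ "if i = 1 then 0 else 3"]) auto
  qed auto
  then show "proper_coloring (glued_bicliques n) 2 (\<lambda>v. if v < 3 then 1 else 2)"
    by (auto simp: proper_coloring_def glue_edge_def)
next
  fix u v assume "v \<in> pverts (glued_bicliques n)"
  then have v: "v < n" by simp
  \<comment> \<open>Of two distinct neighbours, at least one differs from \<open>u\<close>. The
    bound \<open>7 \<le> n\<close> makes 6 a vertex, which serves as the second neighbour of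
    2.\<close>
  have two: "\<exists>w. w \<noteq> u \<and> (v, w) \<in> parcs (glued_bicliques n)"
    if "a \<noteq> b" "(v, a) \<in> parcs (glued_bicliques n)" "(v, b) \<in> parcs (glued_bicliques n)" for a b
    using that by metis
  consider "v = 0 \<or> v = 1" | "v = 2" | "3 \<le> v" "odd v" | "3 \<le> v" "even v" by linarith
  then show "\<exists>w. w \<noteq> u \<and> (v, w) \<in> parcs (glued_bicliques n)"
  proof cases
    case 1
    then show ?thesis using assms by (intro two[of 3 5]) (auto simp: glue_edge_def)
  next
    case 2
    then show ?thesis using assms by (intro two[of 4 6]) (auto simp: glue_edge_def)
  next
    case 3
    then show ?thesis using assms v by (intro two[of 0 1]) (auto simp: glue_edge_def)
  next
    case 4
    then show ?thesis using assms v by (intro two[of 0 2]) (auto simp: glue_edge_def)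
  qed
qed

theorem theorem5:
  shows "\<exists>\<G> :: nat pair_pre_digraph set.
    infinite \<G> \<and>
    pairwise (\<lambda>G H. \<not> digraph_iso (with_proj G) (with_proj H)) \<G> \<and>
    (\<forall>G\<in>\<G>. pair_graph G \<and> Digraph_Component.connected (with_proj G) \<and>
      vertex_connectivity G = 1 \<and> (\<exists>k c. IRC_coloring G k c))"
proof (rule exI[of _ "glued_bicliques ` {7..}"], intro conjI ballI)
  let ?F = "glued_bicliques ` {7..}"
  have "inj glued_bicliques"
    by (rule injI) (metis card_lessThan glued_bicliques_simps(1))
  then show "infinite ?F"
    by (metis finite_imageD infinite_Ici inj_on_subset subset_UNIV)
  \<comment> \<open>The number of vertices is an isomorphism invariant, and it recovers
    \<open>n\<close> from \<open>glued_bicliques n\<close>.\<close>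
  show "pairwise (\<lambda>G H. \<not> digraph_iso (with_proj G) (with_proj H)) ?F"
    by (auto simp: pairwise_def dest!: digraph_iso_card_verts)
  fix G assume "G \<in> ?F"
  then obtain n where n: "7 \<le> n" and G: "G = glued_bicliques n" by auto
  show "pair_graph G" using G pair_graph_glued_bicliques by simp
  then have wf: "pair_wf_digraph G"
    using pair_graph_def pair_digraph.pair_wf_digraph by blast
  show conn: "Digraph_Component.connected (with_proj G)"
    using G n connected_glued_bicliques by simp
  show "vertex_connectivity G = 1"
    using n not_connected_glued_bicliques_minus_0[OF n] conn wf
    by (intro vertex_connectivity_eq_1I[of _ 0]) (auto simp: G)
  show "\<exists>k c. IRC_coloring G k c"
    using IRC_coloring_glued_bicliques[OF n] G by blast
qed

end
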